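(* $g(K_n,K_5)\le n^{o(1)}$; that is, there is a function $\varepsilon(n)\to 0$ as $n\to\infty$ such that for every $n$ the edges of $K_n$ can be colored with at most $n^{\varepsilon(n)}$ colors so that every copy of $K_5$ in $K_n$ contains some color an odd number of times.
   Context: For graphs $G$ and $H$, $g(G,H)$ denotes the minimum number of colors in an edge-coloring of $G$ such that every copy of $H$ in $G$ has an odd color class, i.e. some color appears on an odd number of the edges of that copy. *)

theory Defs
  imports Complex_Main
begin

text \<open>A graph is a pair of a vertex set and a set of edges, an edge being a 2-element set of
  vertices.\<close>

type_synonym 'a graph = "'a set \<times> 'a set set"

definition verts :: "'a graph \<Rightarrow> 'a set" where
  "verts G = fst G"

definition edges :: "'a graph \<Rightarrow> 'a set set" where
  "edges G = snd G"

definition complete_graph :: "nat \<Rightarrow> nat graph" where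
  "complete_graph n = ({..<n}, {e. e \<subseteq> {..<n} \<and> card e = 2})"

definition subgraph :: "'a graph \<Rightarrow> 'a graph \<Rightarrow> bool" where
  "subgraph F G \<longleftrightarrow> verts F \<subseteq> verts G \<and> edges F \<subseteq> edges G"

definition graph_iso :: "'b graph \<Rightarrow> 'a graph \<Rightarrow> bool" where
  "graph_iso H F \<longleftrightarrow>
     (\<exists>f. bij_betw f (verts H) (verts F) \<and> edges F = (\<lambda>e. f ` e) ` edges H)"

text \<open>Copies need not be induced subgraphs.\<close>

definition is_copy :: "'b graph \<Rightarrow> 'a graph \<Rightarrow> 'a graph \<Rightarrow> bool" where
  "is_copy H G F \<longleftrightarrow> subgraph F G \<and> graph_iso H F"

text \<open>The colors are \<open>0, \<dots>, k - 1\<close>; neither properness nor use of every color is required.\<close>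

definition edge_coloring :: "'a graph \<Rightarrow> nat \<Rightarrow> ('a set \<Rightarrow> nat) \<Rightarrow> bool" where
  "edge_coloring G k c \<longleftrightarrow> (\<forall>e\<in>edges G. c e < k)"

definition has_odd_color_class :: "('a set \<Rightarrow> nat) \<Rightarrow> 'a graph \<Rightarrow> bool" where
  "has_odd_color_class c F \<longleftrightarrow> (\<exists>i. odd (card {e \<in> edges F. c e = i}))"

definition odd_coloring :: "'a graph \<Rightarrow> 'b graph \<Rightarrow> nat \<Rightarrow> ('a set \<Rightarrow> nat) \<Rightarrow> bool" where
  "odd_coloring G H k c \<longleftrightarrow>
     edge_coloring G k c \<and> (\<forall>F. is_copy H G F \<longrightarrow> has_odd_color_class c F)"

text \<open>The minimum is over a nonempty set when \<open>G\<close> is finite and \<open>H\<close> has an edge and finitely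
  many edges: give the edges of \<open>G\<close> pairwise distinct colors.\<close>

definition g :: "'a graph \<Rightarrow> 'b graph \<Rightarrow> nat" where
  "g G H = (LEAST k. \<exists>c. odd_coloring G H k c)"

end

theory Submission
  imports Defs "HOL-Library.FuncSet" "HOL-Real_Asymp.Real_Asymp"
begin

text \<open>
  Encode the vertices as words of length \<open>d\<close> over an alphabet of size \<open>q\<close> and color a pair of words
  by the first position where they differ, the two letters there, and, for every position, which of
  the two words has the larger letter. These are \<open>d q\<^sup>2 3\<^sup>d\<close> colors, and \<open>d = \<lceil>\<surd>(log 2 n)\<rceil>\<close>,
  \<open>q = 2\<^sup>d\<close> makes this \<open>n\<close> to a power tending to \<open>0\<close>.

  In fact every five words have a pair whose color occurs only once. Otherwise take a pair \<open>a b\<close>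
  splitting at the last possible position \<open>k\<close>; its color recurs on a disjoint pair \<open>c d\<close>, with
  letters \<open>\<alpha> < \<beta>\<close> at \<open>k\<close> on both. The pairs \<open>a d\<close> and \<open>b c\<close> compare in opposite ways at \<open>k\<close>,
  while \<open>a c\<close> and \<open>b d\<close> agree there, so the fifth word \<open>e\<close> must supply the repetitions of both
  colors. This forces the letter of \<open>e\<close> at \<open>k\<close> strictly between \<open>\<alpha>\<close> and \<open>\<beta>\<close>, and puts \<open>e\<close> on the
  side of \<open>a b\<close> or of \<open>c d\<close>; then the pair joining \<open>e\<close> to a word on its own side is unique.
\<close>

section \<open>Words and their first difference\<close>

definition less_at :: "nat \<Rightarrow> (nat \<Rightarrow> nat) \<Rightarrow> (nat \<Rightarrow> nat) \<Rightarrow> bool" where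
  "less_at i x y \<longleftrightarrow> (\<forall>l<i. x l = y l) \<and> x i < y i"

lemma less_at_exists:
  assumes "x \<in> PiE {..<d} (\<lambda>_. A)" "y \<in> PiE {..<d} (\<lambda>_. A)" "x \<noteq> y"
  shows "\<exists>i<d. less_at i x y \<or> less_at i y x"
proof -
  define i where "i = (LEAST i. x i \<noteq> y i)"
  have ex: "\<exists>i. x i \<noteq> y i" using assms(3) by auto
  have 1: "x i \<noteq> y i" unfolding i_def by (rule LeastI_ex[OF ex])
  have 2: "x l = y l" if "l < i" for l
    using that not_less_Least unfolding i_def by blast
  have "i < d"
  proof (rule ccontr)
    assume "\<not> i < d"
    \<comment> \<open>Extensional functions all take the value \<open>undefined\<close> from
      \<open>d\<close> on, so two of them cannot first differ there.\<close>
    then have "x i = undefined" "y i = undefined" using assms(1,2) by (auto simp: PiE_def extensional_def)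
    with 1 show False by simp
  qed
  with 1 2 show ?thesis unfolding less_at_def by (metis linorder_neqE_nat)
qed

lemma less_at_unique: "less_at i x y \<Longrightarrow> less_at j x y \<Longrightarrow> i = j"
  unfolding less_at_def by (metis linorder_neqE_nat less_irrefl)

lemma less_at_asym: "less_at i x y \<Longrightarrow> \<not> less_at j y x"
  unfolding less_at_def by (metis linorder_neqE_nat less_irrefl less_asym)

lemma less_at_agree:
  assumes "less_at j x y" "\<And>l. l \<le> j \<Longrightarrow> x' l = x l" "\<And>l. l \<le> j \<Longrightarrow> y' l = y l"
  shows "less_at j x' y'"
  using assms unfolding less_at_def by auto

section \<open>Types of pairs, and a unique type among any five words\<close>

text \<open>Working in \<open>int\<close> avoids truncated subtraction, and restricting to
  \<open>{..<d}\<close> leaves at most \<open>3 ^ d\<close> vectors.\<close>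

definition sgn_diff :: "nat \<Rightarrow> (nat \<Rightarrow> nat) \<Rightarrow> (nat \<Rightarrow> nat) \<Rightarrow> nat \<Rightarrow> int" where
  "sgn_diff d x y = (\<lambda>l\<in>{..<d}. sgn (int (y l) - int (x l)))"

text \<open>When \<open>less_at i x y\<close> holds, this is equality of colors for the two pairs,
  each oriented lexicographically.\<close>

definition same_type :: "nat \<Rightarrow> nat \<Rightarrow> (nat \<Rightarrow> nat) \<Rightarrow> (nat \<Rightarrow> nat) \<Rightarrow> (nat \<Rightarrow> nat) \<Rightarrow> (nat \<Rightarrow> nat) \<Rightarrow> bool"
  where "same_type d i x y u v \<longleftrightarrow>
    less_at i u v \<and> u i = x i \<and> v i = y i \<and> sgn_diff d u v = sgn_diff d x y"

lemma same_type_less: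
  assumes "same_type d i x y u v" "l < d"
  shows "u l < v l \<longleftrightarrow> x l < y l" "v l < u l \<longleftrightarrow> y l < x l"
proof -
  have "sgn_diff d u v l = sgn_diff d x y l" using assms(1) unfolding same_type_def by simp
  then have "sgn (int (v l) - int (u l)) = sgn (int (y l) - int (x l))"
    using assms(2) by (simp add: sgn_diff_def)
  then show "u l < v l \<longleftrightarrow> x l < y l" "v l < u l \<longleftrightarrow> y l < x l"
    by (auto simp: sgn_if split: if_splits)
qed

text \<open>The configuration in which \<open>e\<close> lies on the side of \<open>a b\<close>, i.e. \<open>m\<close>, where \<open>a\<close> and \<open>e\<close>
  split, comes after \<open>j\<close>, where \<open>c d\<close> splits off.\<close>

lemma unique_near_pair:
  assumes S: "S = {a, b, c, d, e}" and k: "k < n"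
    and ab: "less_at k a b" and cd: "less_at k c d" and ck: "c k = a k" "d k = b k"
    and cross: "\<And>x y. x \<in> {a, b, e} \<Longrightarrow> y \<in> {c, d} \<Longrightarrow> less_at j x y \<or> less_at j y x"
    and e: "a k < e k" "e k < b k"
    and m: "less_at m a e \<or> less_at m e a" "m \<noteq> j" "m \<le> k"
  shows "\<exists>x\<in>S. \<exists>y\<in>S. \<exists>i. less_at i x y \<and>
           (\<forall>u\<in>S. \<forall>v\<in>S. same_type n i x y u v \<longrightarrow> u = x \<and> v = y)"
proof -
  \<comment> \<open>Pairs between the two sides split at \<open>j\<close>, and the split position of
    a pair is unique.\<close>
  have nocross: "\<not> less_at m x y" "\<not> less_at m y x" if "x \<in> {a, b, e}" "y \<in> {c, d}" for x y
    using cross[OF that] m(2) less_at_unique[of m] less_at_asym[of m] by blast+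
  have nrefl: "\<not> less_at m x x" for x by (simp add: less_at_def)
  have noncross: "(u \<in> {a, b, e} \<and> v \<in> {a, b, e}) \<or> (u = c \<and> v = d) \<or> (u = d \<and> v = c)"
    if "u \<in> S" "v \<in> S" "less_at m u v" for u v
    using that nocross[of u v] nocross[of v u] nrefl[of u] unfolding S by auto
  show ?thesis
  proof (cases "m = k")
    case True
    with m e have ae: "less_at k a e" by (auto simp: less_at_def)
    \<comment> \<open>The letters at \<open>k\<close> alone decide: \<open>a k < e k < b k\<close>
      separates \<open>a\<close>, \<open>b\<close>, \<open>e\<close>, and neither \<open>c\<close>
      nor \<open>d\<close> has the letter \<open>e k\<close>.\<close>
    have "u = a \<and> v = e" if "u \<in> S" "v \<in> S" "same_type n k a e u v" for u v
    proof -
      have uv: "less_at k u v" "u k = a k" "v k = e k" using that(3) by (auto simp: same_type_def)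
      from noncross[OF that(1,2)] uv(1) True
      have "(u \<in> {a, b, e} \<and> v \<in> {a, b, e}) \<or> (u = c \<and> v = d) \<or> (u = d \<and> v = c)" by simp
      with uv e ck show ?thesis by auto
    qed
    then show ?thesis using ae unfolding S by blast
  next
    case False
    with m have mk: "m < k" by simp
    \<comment> \<open>Here \<open>a\<close> and \<open>b\<close> agree through \<open>m\<close>, so
      the pairs of \<open>e\<close> with \<open>a\<close> and with \<open>b\<close> have the same
      split and letters. The comparison at \<open>k\<close> tells them apart, as
      \<open>a k < e k < b k\<close>.\<close>
    then have am: "a l = b l" if "l \<le> m" for l using ab that by (auto simp: less_at_def)
    have nab: "\<not> less_at m a b" "\<not> less_at m b a" "\<not> less_at m c d" "\<not> less_at m d c"
      using ab cd mk by (auto simp: less_at_def)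
    have ends: "(u = e \<and> v \<in> {a, b}) \<or> (v = e \<and> u \<in> {a, b})"
      if "u \<in> S" "v \<in> S" "less_at m u v" for u v
      using noncross[OF that] that(3) nab nrefl[of u] by auto
    from m(1) show ?thesis
    proof
      assume ae: "less_at m a e"
      then have be: "less_at m b e" using am by (auto simp: less_at_def)
      have "u = a \<and> v = e" if "u \<in> S" "v \<in> S" "same_type n m a e u v" for u v
        using ends[OF that(1,2)] same_type_less[OF that(3) k] that(3) ae be e
        by (auto simp: same_type_def dest: less_at_asym)
      then show ?thesis using ae unfolding S by blast
    next
      assume ae: "less_at m e a"
      then have be: "less_at m e b" using am by (auto simp: less_at_def)
      have "u = e \<and> v = a" if "u \<in> S" "v \<in> S" "same_type n m e a u v" for u v
        using ends[OF that(1,2)] same_type_less[OF that(3) k] that(3) ae be e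
        by (auto simp: same_type_def dest: less_at_asym)
      then show ?thesis using ae unfolding S by blast
    qed
  qed
qed

text \<open>The maximality of \<open>k\<close> enters as \<open>split\<close>. The pair
  \<open>a b\<close> is taken to precede \<open>c d\<close> lexicographically; exchanging the pairs
  covers the other order.\<close>

lemma unique_type_two_pairs:
  assumes S: "S = {a, b, c, d, e}" and k: "k < n"
    and split: "\<And>x y. x \<in> S \<Longrightarrow> y \<in> S \<Longrightarrow> x \<noteq> y \<Longrightarrow> \<exists>i\<le>k. less_at i x y \<or> less_at i y x"
    and ab: "less_at k a b" and cd: "less_at k c d" and ck: "c k = a k" "d k = b k"
    and ac: "less_at j a c" and jk: "j < k"
  shows "\<exists>x\<in>S. \<exists>y\<in>S. \<exists>i. less_at i x y \<and>
           (\<forall>u\<in>S. \<forall>v\<in>S. same_type n i x y u v \<longrightarrow> u = x \<and> v = y)" (is ?goal)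
proof (rule ccontr)
  assume no: "\<not> ?goal"
  have dup: "\<exists>u\<in>S. \<exists>v\<in>S. same_type n i x y u v \<and> \<not> (u = x \<and> v = y)"
    if "x \<in> S" "y \<in> S" "less_at i x y" for x y i
    using no that by blast
  \<comment> \<open>As \<open>j < k\<close>, the words \<open>a\<close>, \<open>b\<close> agree
    through \<open>j\<close>, and so do \<open>c\<close>, \<open>d\<close>. All four cross pairs
    thus split at \<open>j\<close> with the same letters, and only the sign vectors can distinguish
    them.\<close>
  have aj: "b l = a l" "d l = c l" if "l \<le> j" for l
    using ab cd jk that by (auto simp: less_at_def)
  have ad: "less_at j a d" and bc: "less_at j b c" and bd: "less_at j b d"
    using ac by (auto intro!: less_at_agree[OF ac] simp: aj)
  have akbk: "a k < b k" using ab by (simp add: less_at_def)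
  have ajcj: "a j < c j" using ac by (simp add: less_at_def)
  have cross: "(x \<in> {a, b} \<and> y \<in> {c, d}) \<or> (x = e \<and> y \<in> {c, d}) \<or> (x \<in> {a, b} \<and> y = e)"
    if "x \<in> S" "y \<in> S" "less_at j x y" "x j = a j" "y j = c j" for x y
    using that ajcj aj[of j] unfolding S by auto
  \<comment> \<open>A second pair of the type of \<open>(a, d)\<close> must contain \<open>e\<close>
    and increase at \<open>k\<close>. Its other word has letter \<open>a k\<close> or
    \<open>b k\<close> there, so the weaker of the two bounds holds in either case.\<close>
  have e1: "(less_at j e c \<and> e j = a j \<and> e k < b k) \<or> (less_at j a e \<and> e j = c j \<and> a k < e k)"
  proof -
    obtain u v where uv: "u \<in> S" "v \<in> S" "same_type n j a d u v" "\<not> (u = a \<and> v = d)"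
      using dup[OF _ _ ad] unfolding S by blast
    have L: "less_at j u v" "u j = a j" "v j = c j"
      using uv(3) aj[of j] by (auto simp: same_type_def)
    have K: "u k < v k" using same_type_less(1)[OF uv(3) k] ck akbk by simp
    from cross[OF uv(1,2) L] show ?thesis
    proof (elim disjE conjE)
      assume "u \<in> {a, b}" "v \<in> {c, d}"
      with uv(4) K ck akbk show ?thesis by auto
    next
      assume *: "u = e" "v \<in> {c, d}"
      then have "less_at j e c" by (intro less_at_agree[OF L(1)]) (auto simp: aj)
      moreover have "e k < b k" using * K ck akbk by auto
      ultimately show ?thesis using * L by blast
    next
      assume *: "u \<in> {a, b}" "v = e"
      then have "less_at j a e" by (intro less_at_agree[OF L(1)]) (auto simp: aj)
      moreover have "a k < e k" using * K ck akbk by auto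
      ultimately show ?thesis using * L by blast
    qed
  qed
  \<comment> \<open>The same for \<open>(b, c)\<close>, whose type decreases at \<open>k\<close>;
    the bounds on \<open>e k\<close> are interchanged.\<close>
  have e2: "(less_at j e c \<and> e j = a j \<and> a k < e k) \<or> (less_at j a e \<and> e j = c j \<and> e k < b k)"
  proof -
    obtain u v where uv: "u \<in> S" "v \<in> S" "same_type n j b c u v" "\<not> (u = b \<and> v = c)"
      using dup[OF _ _ bc] unfolding S by blast
    have L: "less_at j u v" "u j = a j" "v j = c j"
      using uv(3) aj[of j] by (auto simp: same_type_def)
    have K: "v k < u k" using same_type_less(2)[OF uv(3) k] ck akbk by simp
    from cross[OF uv(1,2) L] show ?thesis
    proof (elim disjE conjE)
      assume "u \<in> {a, b}" "v \<in> {c, d}"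
      with uv(4) K ck akbk show ?thesis by auto
    next
      assume *: "u = e" "v \<in> {c, d}"
      then have "less_at j e c" by (intro less_at_agree[OF L(1)]) (auto simp: aj)
      moreover have "a k < e k" using * K ck akbk by auto
      ultimately show ?thesis using * L by blast
    next
      assume *: "u \<in> {a, b}" "v = e"
      then have "less_at j a e" by (intro less_at_agree[OF L(1)]) (auto simp: aj)
      moreover have "e k < b k" using * K ck akbk by auto
      ultimately show ?thesis using * L by blast
    qed
  qed
  \<comment> \<open>Since \<open>a j < c j\<close>, both disjunctions must put \<open>e\<close> on
    the same side, and there they supply the two different bounds.\<close>
  have ek: "a k < e k" "e k < b k" and side: "less_at j e c \<and> e j = a j \<or> less_at j a e \<and> e j = c j"
    using e1 e2 ajcj by auto
  have ne: "e \<noteq> a" "e \<noteq> c" using ek ck by auto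
  from side show False
  proof (elim disjE conjE)
    assume ec: "less_at j e c" "e j = a j"
    then have ed: "less_at j e d" by (auto intro!: less_at_agree[OF ec(1)] simp: aj)
    obtain m where m: "m \<le> k" "less_at m a e \<or> less_at m e a"
      using split[of a e] ne unfolding S by auto
    have "m \<noteq> j" using m(2) ec(2) by (auto simp: less_at_def)
    have "?goal"
      by (rule unique_near_pair[OF S k ab cd ck _ ek m(2) \<open>m \<noteq> j\<close> m(1)])
         (use ac ad bc bd ec ed in auto)
    with no show False by blast
  next
    \<comment> \<open>The mirror case: \<open>e\<close> sides with \<open>c d\<close>, so
      \<open>unique_near_pair\<close> is applied with the two pairs exchanged.\<close>
    assume ae: "less_at j a e" "e j = c j"
    then have be: "less_at j b e" by (auto intro!: less_at_agree[OF ae(1)] simp: aj)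
    obtain m where m: "m \<le> k" "less_at m c e \<or> less_at m e c"
      using split[of c e] ne unfolding S by auto
    have "m \<noteq> j" using m(2) ae(2) by (auto simp: less_at_def)
    have S': "S = {c, d, a, b, e}" using S by auto
    have "?goal"
      by (rule unique_near_pair[OF S' k cd ab ck[symmetric] _ _ _ m(2) \<open>m \<noteq> j\<close> m(1)])
         (use ac ad bc bd ae be ek ck in auto)
    with no show False by blast
  qed
qed

text \<open>Taking \<open>k\<close> as the last split position makes the repeated pair disjoint from
  \<open>a b\<close>; the one remaining word then completes the configuration of
  \<open>unique_type_two_pairs\<close>.\<close>

lemma unique_type_five:
  assumes fin: "card S = 5" and SP: "S \<subseteq> PiE {..<n} (\<lambda>_. A)"
  shows "\<exists>x\<in>S. \<exists>y\<in>S. \<exists>i. less_at i x y \<and>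
           (\<forall>u\<in>S. \<forall>v\<in>S. same_type n i x y u v \<longrightarrow> u = x \<and> v = y)" (is ?goal)
proof (rule ccontr)
  assume no: "\<not> ?goal"
  have ex: "\<exists>i<n. less_at i x y \<or> less_at i y x" if "x \<in> S" "y \<in> S" "x \<noteq> y" for x y
    using less_at_exists[of x n A y] SP that by blast
  define I where "I = {i. i < n \<and> (\<exists>x\<in>S. \<exists>y\<in>S. less_at i x y)}"
  have finI: "finite I" unfolding I_def by simp
  have finS: "finite S" by (rule card_ge_0_finite) (simp add: fin)
  obtain x0 y0 where "x0 \<in> S" "y0 \<in> S" "x0 \<noteq> y0"
    using card_le_Suc0_iff_eq[OF finS] fin by auto
  then have "I \<noteq> {}" using ex unfolding I_def by blast
  define k where "k = Max I"
  have "k \<in> I" unfolding k_def using finI \<open>I \<noteq> {}\<close> by (rule Max_in)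
  then obtain a b where k: "k < n" and a: "a \<in> S" "b \<in> S" and ab: "less_at k a b"
    unfolding I_def by blast
  have split: "\<exists>i\<le>k. less_at i x y \<or> less_at i y x" if "x \<in> S" "y \<in> S" "x \<noteq> y" for x y
  proof -
    obtain i where i: "i < n" "less_at i x y \<or> less_at i y x" using ex[OF \<open>x \<in> S\<close> \<open>y \<in> S\<close> \<open>x \<noteq> y\<close>] by blast
    then have "i \<in> I" using that unfolding I_def by blast
    then have "i \<le> k" unfolding k_def using finI by simp
    with i show ?thesis by blast
  qed
  have eqI: "x = y" if "x \<in> S" "y \<in> S" "\<And>l. l \<le> k \<Longrightarrow> x l = y l" for x y
    using split[OF that(1,2)] that(3) unfolding less_at_def by (metis less_irrefl)
  obtain c d where c: "c \<in> S" "d \<in> S" "same_type n k a b c d" "\<not> (c = a \<and> d = b)"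
    using no a ab by blast
  then have cd: "less_at k c d" and ck: "c k = a k" "d k = b k" by (auto simp: same_type_def)
  have akbk: "a k < b k" using ab by (simp add: less_at_def)
  \<comment> \<open>If the pairs shared their lower word, the upper ones would agree before
    \<open>k\<close> and at \<open>k\<close>, hence be equal by \<open>eqI\<close>.\<close>
  have "a \<noteq> c"
  proof
    assume "a = c"
    have "b l = d l" if "l \<le> k" for l
      using ab cd ck \<open>a = c\<close> that unfolding less_at_def le_less by metis
    with a c have "b = d" by (intro eqI)
    with c \<open>a = c\<close> show False by simp
  qed
  moreover have "b \<noteq> d"
  proof
    assume "b = d"
    have "a l = c l" if "l \<le> k" for l
      using ab cd ck \<open>b = d\<close> that unfolding less_at_def le_less by metis
    with a c have "a = c" by (intro eqI)
    with \<open>a \<noteq> c\<close> show False by simp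
  qed
  moreover have "a \<noteq> b" "a \<noteq> d" "b \<noteq> c" "c \<noteq> d" using akbk ck by auto
  ultimately have "card {a, b, c, d} = 4" by simp
  then have "card (S - {a, b, c, d}) = 1" using fin a c by (subst card_Diff_subset) auto
  then obtain e where "S - {a, b, c, d} = {e}" by (rule card_1_singletonE)
  then have S: "S = {a, b, c, d, e}" and S': "S = {c, d, a, b, e}" using a c by auto
  obtain j where j: "j \<le> k" "less_at j a c \<or> less_at j c a"
    using split[OF a(1) c(1) \<open>a \<noteq> c\<close>] by blast
  have "j \<noteq> k" using j(2) ck by (auto simp: less_at_def)
  with j have "j < k" by simp
  from j(2) show False
  proof
    assume "less_at j a c"
    from unique_type_two_pairs[OF S k split ab cd ck this \<open>j < k\<close>] no show False by simp
  next
    assume "less_at j c a"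
    from unique_type_two_pairs[OF S' k split cd ab ck[symmetric] this \<open>j < k\<close>] no show False by simp
  qed
qed

section \<open>Coloring the complete graph by types\<close>

text \<open>A color belongs to an unordered pair. Only one orientation is lexicographically
  increasing, so \<open>SOME\<close> has a single candidate for distinct words.\<close>

definition pair_type :: "nat \<Rightarrow> (nat \<Rightarrow> nat) set \<Rightarrow> nat \<times> nat \<times> nat \<times> (nat \<Rightarrow> int)" where
  "pair_type d E = (SOME t. \<exists>x y i. E = {x, y} \<and> less_at i x y \<and> t = (i, x i, y i, sgn_diff d x y))"

lemma pair_type_eq:
  assumes "less_at i x y"
  shows "pair_type d {x, y} = (i, x i, y i, sgn_diff d x y)"
  unfolding pair_type_def
proof (rule some_equality)
  show "\<exists>x' y' i'. {x, y} = {x', y'} \<and> less_at i' x' y' \<and>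
      (i, x i, y i, sgn_diff d x y) = (i', x' i', y' i', sgn_diff d x' y')"
    using assms by blast
next
  fix t
  assume "\<exists>x' y' i'. {x, y} = {x', y'} \<and> less_at i' x' y' \<and> t = (i', x' i', y' i', sgn_diff d x' y')"
  then obtain x' y' i' where *: "{x, y} = {x', y'}" "less_at i' x' y'"
    "t = (i', x' i', y' i', sgn_diff d x' y')" by blast
  have "x' = x" "y' = y" using *(1,2) assms less_at_asym by (auto simp: doubleton_eq_iff)
  moreover from this have "i' = i" using *(2) assms less_at_unique by blast
  ultimately show "t = (i, x i, y i, sgn_diff d x y)" using *(3) by simp
qed

definition types :: "nat \<Rightarrow> nat \<Rightarrow> (nat \<times> nat \<times> nat \<times> (nat \<Rightarrow> int)) set" where
  "types d q = {..<d} \<times> {..<q} \<times> {..<q} \<times> PiE {..<d} (\<lambda>_. {-1, 0, 1})"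

lemma finite_types: "finite (types d q)"
  unfolding types_def by (intro finite_cartesian_product finite_PiE) auto

lemma card_types: "card (types d q) = d * (q * (q * 3 ^ d))"
  unfolding types_def by (simp add: card_cartesian_product card_PiE numeral_3_eq_3)

lemma pair_type_in_types:
  assumes "x \<in> PiE {..<d} (\<lambda>_. {..<q})" "y \<in> PiE {..<d} (\<lambda>_. {..<q})" "x \<noteq> y"
  shows "\<exists>i. (less_at i x y \<or> less_at i y x) \<and> pair_type d {x, y} \<in> types d q"
proof -
  have sd: "sgn_diff d u v \<in> PiE {..<d} (\<lambda>_. {-1, 0, 1})" for u v
    unfolding sgn_diff_def by (auto simp: sgn_if)
  obtain i where i: "i < d" "less_at i x y \<or> less_at i y x" using less_at_exists[OF assms] by blast
  have "x i < q" "y i < q" using assms i(1) by auto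
  with i sd have "pair_type d {x, y} \<in> types d q"
    using pair_type_eq[of i x y d] pair_type_eq[of i y x d]
    by (auto simp: types_def insert_commute)
  with i show ?thesis by blast
qed

text \<open>A bijection of vertices carries 2-subsets onto 2-subsets, so a copy is determined by its
  vertex set and the result on sets of five words applies.\<close>

lemma copy_of_complete_graph:
  assumes "is_copy (complete_graph m) (complete_graph n) F"
  shows "verts F \<subseteq> {..<n}" "card (verts F) = m" "edges F = {e. e \<subseteq> verts F \<and> card e = 2}"
proof -
  from assms obtain f where sub: "subgraph F (complete_graph n)"
    and f: "bij_betw f {..<m} (verts F)"
    and ed: "edges F = (\<lambda>e. f ` e) ` {e. e \<subseteq> {..<m} \<and> card e = 2}"
    unfolding is_copy_def graph_iso_def by (auto simp: verts_def edges_def complete_graph_def)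
  show "verts F \<subseteq> {..<n}" using sub by (simp add: subgraph_def verts_def complete_graph_def)
  show "card (verts F) = m" using bij_betw_same_card[OF f] by simp
  have inj: "inj_on f {..<m}" and im: "f ` {..<m} = verts F" using f by (auto simp: bij_betw_def)
  have card: "card (f ` e) = card e" if "e \<subseteq> {..<m}" for e
    using inj_on_subset[OF inj that] by (rule card_image)
  show "edges F = {e. e \<subseteq> verts F \<and> card e = 2}"
  proof (intro set_eqI iffI)
    fix e assume "e \<in> edges F"
    then show "e \<in> {e. e \<subseteq> verts F \<and> card e = 2}" using card im unfolding ed by auto
  next
    fix e assume e: "e \<in> {e. e \<subseteq> verts F \<and> card e = 2}"
    then have "e \<subseteq> f ` {..<m}" using im by simp
    then obtain e' where e': "e' \<subseteq> {..<m}" "e = f ` e'" by (rule subset_imageE)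
    moreover have "card e' = 2" using card[OF e'(1)] e e'(2) by simp
    ultimately show "e \<in> edges F" unfolding ed by auto
  qed
qed

lemma odd_coloring_exists:
  assumes nq: "n \<le> q ^ d"
  shows "\<exists>c. odd_coloring (complete_graph n) (complete_graph 5) (d * (q * (q * 3 ^ d))) c"
proof -
  let ?W = "PiE {..<d} (\<lambda>_. {..<q})"
  have "card {..<n} \<le> card ?W" using nq by (simp add: card_PiE)
  then obtain s :: "nat \<Rightarrow> nat \<Rightarrow> nat" where s: "s ` {..<n} \<subseteq> ?W" "inj_on s {..<n}"
    using card_le_inj[of "{..<n}" ?W] by (auto intro: finite_PiE)
  obtain h where h: "bij_betw h (types d q) {0..<card (types d q)}"
    using ex_bij_betw_finite_nat[OF finite_types] by blast
  define c where "c e = h (pair_type d (s ` e))" for e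
  have pair: "pair_type d (s ` e) \<in> types d q \<and>
      (\<exists>u v i. e = {u, v} \<and> less_at i (s u) (s v))" if e: "e \<subseteq> {..<n}" "card e = 2" for e
  proof -
    obtain u v where uv: "e = {u, v}" "u \<noteq> v" using e(2) by (auto simp: card_2_iff)
    have "s u \<noteq> s v" "s u \<in> ?W" "s v \<in> ?W" using uv e(1) s by (auto dest: inj_onD)
    from pair_type_in_types[OF this(2,3,1)] show ?thesis
      using uv(1) by (auto simp: insert_commute)
  qed
  have "edge_coloring (complete_graph n) (d * (q * (q * 3 ^ d))) c"
    unfolding edge_coloring_def
  proof
    fix e assume "e \<in> edges (complete_graph n)"
    then have "pair_type d (s ` e) \<in> types d q"
      using pair by (simp add: edges_def complete_graph_def)
    then have "h (pair_type d (s ` e)) \<in> {0..<card (types d q)}"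
      using h by (rule bij_betwE[THEN bspec, rotated])
    then show "c e < d * (q * (q * 3 ^ d))" by (simp add: c_def card_types)
  qed
  moreover have "has_odd_color_class c F"
    if copy: "is_copy (complete_graph 5) (complete_graph n) F" for F
  proof -
    note F = copy_of_complete_graph[OF copy]
    have "inj_on s (verts F)" using s(2) F(1) by (rule inj_on_subset)
    then have "card (s ` verts F) = 5" using F(2) by (simp add: card_image)
    moreover have "s ` verts F \<subseteq> ?W" using s(1) F(1) by blast
    ultimately obtain p r i where pr: "p \<in> verts F" "r \<in> verts F" "less_at i (s p) (s r)"
      and uniq: "\<And>u v. u \<in> verts F \<Longrightarrow> v \<in> verts F \<Longrightarrow> same_type d i (s p) (s r) (s u) (s v)
        \<Longrightarrow> s u = s p \<and> s v = s r"
      using unique_type_five[of "s ` verts F" d "{..<q}"] by blast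
    have ne: "p \<noteq> r" using pr(3) by (auto simp: less_at_def)
    have "e = {p, r}" if e: "e \<in> edges F" and ce: "c e = c {p, r}" for e
    proof -
      have e': "e \<subseteq> verts F" "card e = 2" using e F(3) by auto
      then have "e \<subseteq> {..<n}" using F(1) by blast
      from pair[OF this e'(2)] obtain u v j where t: "pair_type d (s ` e) \<in> types d q"
        and uv: "e = {u, v}" "less_at j (s u) (s v)" by blast
      \<comment> \<open>Both types must lie in \<open>types d q\<close>, the set on which the
        numbering \<open>h\<close> is injective.\<close>
      have "pair_type d (s ` {p, r}) \<in> types d q" using pair[of "{p, r}"] pr F(1) ne by auto
      with t ce h have "pair_type d (s ` e) = pair_type d (s ` {p, r})"
        unfolding c_def bij_betw_def by (auto dest: inj_onD)
      then have "same_type d i (s p) (s r) (s u) (s v)"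
        using uv pr(3) by (auto simp: pair_type_eq same_type_def)
      then have "s u = s p" "s v = s r" using uniq[of u v] uv e'(1) by auto
      then show ?thesis using uv e'(1) pr F(1) s(2) by (metis insert_subset subsetD inj_onD)
    qed
    \<comment> \<open>A color used exactly once gives a class of size 1, which is odd.\<close>
    then have "{e \<in> edges F. c e = c {p, r}} = {{p, r}}" using pr ne F(3) by auto
    then show ?thesis unfolding has_odd_color_class_def by (metis card_1_singleton_iff odd_one One_nat_def)
  qed
  ultimately show ?thesis unfolding odd_coloring_def by blast
qed

section \<open>Choice of parameters and asymptotics\<close>

text \<open>With \<open>q = 2 ^ d\<close> there are \<open>2 ^ (d * d)\<close> words and
  \<open>d * 12 ^ d\<close> colors; \<open>d < 2 ^ d\<close> turns 12 into 24, and the summand 1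
  pays for rounding up \<open>d\<close>.\<close>

lemma odd_coloring_few_colors:
  assumes n: "n \<ge> 2"
  shows "\<exists>k c. real k \<le> 24 powr (sqrt (log 2 n) + 1) \<and>
    odd_coloring (complete_graph n) (complete_graph 5) k c"
proof -
  define d where "d = nat \<lceil>sqrt (log 2 n)\<rceil>"
  have log: "log 2 n \<ge> 0" using n by simp
  then have sqrt: "sqrt (log 2 n) \<ge> 0" by simp
  have d: "sqrt (log 2 n) \<le> real d" "real d \<le> sqrt (log 2 n) + 1"
    unfolding d_def using sqrt by linarith+
  have "log 2 n \<le> real d ^ 2" using d(1) log by (metis sqrt_le_D)
  then have "real n \<le> 2 powr (real (d * d))"
    using n by (simp add: log_le_iff power2_eq_square)
  then have "real n \<le> real (2 ^ (d * d))" by (simp only: powr_realpow of_nat_power of_nat_numeral)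
  then have "n \<le> (2 ^ d) ^ d" unfolding of_nat_le_iff by (simp add: power_mult)
  from odd_coloring_exists[OF this] obtain c where
    c: "odd_coloring (complete_graph n) (complete_graph 5) (d * (2 ^ d * (2 ^ d * 3 ^ d))) c" by blast
  have "real (d * (2 ^ d * (2 ^ d * 3 ^ d))) = real d * 12 ^ d"
    by (simp add: power_mult_distrib[symmetric])
  also have "\<dots> \<le> 2 ^ d * 12 ^ d"
    using of_nat_less_two_power[of d, where 'a = real] by (intro mult_right_mono) auto
  also have "\<dots> = 24 powr real d" by (simp add: powr_realpow power_mult_distrib[symmetric])
  also have "\<dots> \<le> 24 powr (sqrt (log 2 n) + 1)" using d(2) by simp
  finally show ?thesis using c by blast
qed

theorem theorem1:
  shows "\<exists>\<epsilon> :: nat \<Rightarrow> real. \<epsilon> \<longlonglongrightarrow> 0 \<and>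
    (\<forall>n. real (g (complete_graph n) (complete_graph 5)) \<le> real n powr \<epsilon> n \<and>
         (\<exists>k c. real k \<le> real n powr \<epsilon> n \<and>
                odd_coloring (complete_graph n) (complete_graph 5) k c))"
proof -
  \<comment> \<open>Chosen so that \<open>real n powr \<epsilon> n\<close> equals the bound just
    obtained for \<open>n \<ge> 2\<close>; it is of order \<open>1 / sqrt (ln n)\<close>.\<close>
  define \<epsilon> :: "nat \<Rightarrow> real" where "\<epsilon> n = (sqrt (log 2 n) + 1) * ln 24 / ln n" for n
  have lim: "\<epsilon> \<longlonglongrightarrow> 0" unfolding \<epsilon>_def log_def by real_asymp
  have ex: "\<exists>k c. real k \<le> real n powr \<epsilon> n \<and>
      odd_coloring (complete_graph n) (complete_graph 5) k c" for n
  proof (cases "n \<ge> 2")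
    case True
    then have "24 powr (sqrt (log 2 n) + 1) = real n powr \<epsilon> n"
      by (simp add: \<epsilon>_def powr_def)
    with odd_coloring_few_colors[OF True] show ?thesis by simp
  next
    \<comment> \<open>Without edges or copies, 0 colors suffice, and 0 is below any value of
      \<open>powr\<close>, whatever \<open>\<epsilon> n\<close> is.\<close>
    case False
    then have "e \<notin> edges (complete_graph n)" for e
      using card_mono[of "{..<n}" e] by (auto simp: edges_def complete_graph_def)
    moreover have "\<not> is_copy (complete_graph 5) (complete_graph n) F" for F
      using copy_of_complete_graph(1,2)[of 5 n F] card_mono[of "{..<n}" "verts F"] False by auto
    ultimately have "odd_coloring (complete_graph n) (complete_graph 5) 0 (\<lambda>_. 0)"
      by (auto simp: odd_coloring_def edge_coloring_def)
    then show ?thesis by (intro exI[of _ 0]) auto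
  qed
  have "real (g (complete_graph n) (complete_graph 5)) \<le> real n powr \<epsilon> n" for n
  proof -
    obtain k c where "real k \<le> real n powr \<epsilon> n"
      "odd_coloring (complete_graph n) (complete_graph 5) k c" using ex by blast
    moreover from this have "g (complete_graph n) (complete_graph 5) \<le> k"
      unfolding g_def by (intro Least_le) blast
    ultimately show ?thesis by linarith
  qed
  with lim ex show ?thesis by blast
qed

end
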